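(* Let $\Gamma$ be a group. The inclusion functor $i\colon\Gamma\mathbf{BornCoarse}\to\Gamma\mathbf{B\widetilde{orn}Coarse}$ is a fully faithful embedding, but it has neither a left nor a right adjoint.
   Context: For a set $X$, subsets $U,V\subseteq X\times X$ and $B\subseteq X$ put $U^{-1}=\{(x,y)\mid (y,x)\in U\}$, $U\circ V=\{(x,y)\mid \exists z\in X:(x,z)\in U,(z,y)\in V\}$, and $U[B]=\{x\in X\mid\exists b\in B:(x,b)\in U\}$. A generalized bornology on $X$ is a non-empty set $\mathcal{B}_X$ of subsets of $X$ (called bounded) closed under taking subsets and finite unions; it is called a bornology if moreover it contains all finite subsets of $X$. A coarse structure on $X$ is a set $\mathcal{C}_X$ of subsets of $X\times X$ (called entourages) containing the diagonal and closed under taking subsets, finite unions, inverses and compositions. They are compatible if $U[B]\in\mathcal{B}_X$ for all $U\in\mathcal{C}_X$, $B\in\mathcal{B}_X$. A (generalized) bornological coarse space is a set with a coarse structure and a compatible (generalized) bornology. Morphisms are maps $f\colon X\to Y$ that are proper ($f^{-1}(B)\in\mathcal{B}_X$ for all $B\in\mathcal{B}_Y$) and controlled ($(f\times f)(U)\in\mathcal{C}_Y$ for all $U\in\mathcal{C}_X$). A $\Gamma$-equivariant (generalized) bornological coarse space is one with an action of $\Gamma$ by automorphisms such that every entourage is contained in a $\Gamma$-invariant entourage. With $\Gamma$-equivariant morphisms, the $\Gamma$-equivariant bornological coarse spaces form the category $\Gamma\mathbf{BornCoarse}$ and the $\Gamma$-equivariant generalized bornological coarse spaces form the category $\Gamma\mathbf{B\widetilde{orn}Coarse}$.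 *)

theory Defs
  imports "HOL-Algebra.Group_Action"
begin

section \<open>Categories, functors and adjunctions\<close>

text \<open>Categories are presented by their hom-sets. Composition \<open>Comp C X Y Z g f\<close>
  (of \<open>f : X \<rightarrow> Y\<close> followed by \<open>g : Y \<rightarrow> Z\<close>) carries its objects as arguments, so the hom-sets
  need not be disjoint.\<close>

record ('o, 'm) cat =
  Ob :: "'o set"
  Hom :: "'o \<Rightarrow> 'o \<Rightarrow> 'm set"
  Id :: "'o \<Rightarrow> 'm"
  Comp :: "'o \<Rightarrow> 'o \<Rightarrow> 'o \<Rightarrow> 'm \<Rightarrow> 'm \<Rightarrow> 'm"

definition category :: "('o, 'm) cat \<Rightarrow> bool" where
  "category C \<longleftrightarrow>
     (\<forall>X\<in>Ob C. Id C X \<in> Hom C X X) \<and>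
     (\<forall>X\<in>Ob C. \<forall>Y\<in>Ob C. \<forall>Z\<in>Ob C. \<forall>f\<in>Hom C X Y. \<forall>g\<in>Hom C Y Z.
        Comp C X Y Z g f \<in> Hom C X Z) \<and>
     (\<forall>X\<in>Ob C. \<forall>Y\<in>Ob C. \<forall>f\<in>Hom C X Y.
        Comp C X X Y f (Id C X) = f \<and> Comp C X Y Y (Id C Y) f = f) \<and>
     (\<forall>W\<in>Ob C. \<forall>X\<in>Ob C. \<forall>Y\<in>Ob C. \<forall>Z\<in>Ob C.
        \<forall>f\<in>Hom C W X. \<forall>g\<in>Hom C X Y. \<forall>h\<in>Hom C Y Z.
        Comp C W Y Z h (Comp C W X Y g f) = Comp C W X Z (Comp C X Y Z h g) f)"

record ('o, 'm, 'p, 'n) fctr =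
  OMap :: "'o \<Rightarrow> 'p"
  MMap :: "'o \<Rightarrow> 'o \<Rightarrow> 'm \<Rightarrow> 'n"

definition is_functor :: "('o, 'm) cat \<Rightarrow> ('p, 'n) cat \<Rightarrow> ('o, 'm, 'p, 'n) fctr \<Rightarrow> bool" where
  "is_functor C D F \<longleftrightarrow> category C \<and> category D \<and>
     (\<forall>X\<in>Ob C. OMap F X \<in> Ob D) \<and>
     (\<forall>X\<in>Ob C. \<forall>Y\<in>Ob C. \<forall>f\<in>Hom C X Y. MMap F X Y f \<in> Hom D (OMap F X) (OMap F Y)) \<and>
     (\<forall>X\<in>Ob C. MMap F X X (Id C X) = Id D (OMap F X)) \<and>
     (\<forall>X\<in>Ob C. \<forall>Y\<in>Ob C. \<forall>Z\<in>Ob C. \<forall>f\<in>Hom C X Y. \<forall>g\<in>Hom C Y Z.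
        MMap F X Z (Comp C X Y Z g f) =
          Comp D (OMap F X) (OMap F Y) (OMap F Z) (MMap F Y Z g) (MMap F X Y f))"

definition fully_faithful :: "('o, 'm) cat \<Rightarrow> ('p, 'n) cat \<Rightarrow> ('o, 'm, 'p, 'n) fctr \<Rightarrow> bool" where
  "fully_faithful C D F \<longleftrightarrow> is_functor C D F \<and>
     (\<forall>X\<in>Ob C. \<forall>Y\<in>Ob C.
        bij_betw (MMap F X Y) (Hom C X Y) (Hom D (OMap F X) (OMap F Y)))"

definition fully_faithful_embedding ::
  "('o, 'm) cat \<Rightarrow> ('p, 'n) cat \<Rightarrow> ('o, 'm, 'p, 'n) fctr \<Rightarrow> bool" where
  "fully_faithful_embedding C D F \<longleftrightarrow> fully_faithful C D F \<and> inj_on (OMap F) (Ob C)"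

text \<open>\<open>adjunction C D L R \<Phi>\<close>: \<open>L : C \<rightarrow> D\<close> is left adjoint to \<open>R : D \<rightarrow> C\<close>, by bijections
  \<open>\<Phi> X Y : Hom D (L X) Y \<rightarrow> Hom C X (R Y)\<close> natural in \<open>X\<close> (along \<open>u : X' \<rightarrow> X\<close>)
  and in \<open>Y\<close> (along \<open>v : Y \<rightarrow> Y'\<close>).\<close>

definition adjunction ::
  "('o, 'm) cat \<Rightarrow> ('p, 'n) cat \<Rightarrow> ('o, 'm, 'p, 'n) fctr \<Rightarrow> ('p, 'n, 'o, 'm) fctr
    \<Rightarrow> ('o \<Rightarrow> 'p \<Rightarrow> 'n \<Rightarrow> 'm) \<Rightarrow> bool" where
  "adjunction C D L R \<Phi> \<longleftrightarrow> is_functor C D L \<and> is_functor D C R \<and>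
     (\<forall>X\<in>Ob C. \<forall>Y\<in>Ob D. bij_betw (\<Phi> X Y) (Hom D (OMap L X) Y) (Hom C X (OMap R Y))) \<and>
     (\<forall>X\<in>Ob C. \<forall>X'\<in>Ob C. \<forall>Y\<in>Ob D. \<forall>u\<in>Hom C X' X. \<forall>f\<in>Hom D (OMap L X) Y.
        \<Phi> X' Y (Comp D (OMap L X') (OMap L X) Y f (MMap L X' X u)) =
          Comp C X' X (OMap R Y) (\<Phi> X Y f) u) \<and>
     (\<forall>X\<in>Ob C. \<forall>Y\<in>Ob D. \<forall>Y'\<in>Ob D. \<forall>v\<in>Hom D Y Y'. \<forall>f\<in>Hom D (OMap L X) Y.
        \<Phi> X Y' (Comp D (OMap L X) Y Y' v f) =
          Comp C X (OMap R Y) (OMap R Y') (MMap R Y Y' v) (\<Phi> X Y f))"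

definition has_left_adjoint :: "('o, 'm) cat \<Rightarrow> ('p, 'n) cat \<Rightarrow> ('o, 'm, 'p, 'n) fctr \<Rightarrow> bool" where
  "has_left_adjoint C D F \<longleftrightarrow> (\<exists>L \<Phi>. adjunction D C L F \<Phi>)"

definition has_right_adjoint :: "('o, 'm) cat \<Rightarrow> ('p, 'n) cat \<Rightarrow> ('o, 'm, 'p, 'n) fctr \<Rightarrow> bool" where
  "has_right_adjoint C D F \<longleftrightarrow> (\<exists>R \<Phi>. adjunction C D F R \<Phi>)"

section \<open>Bornologies and coarse structures\<close>

definition generalized_bornology :: "'a set \<Rightarrow> 'a set set \<Rightarrow> bool" where
  "generalized_bornology X \<B> \<longleftrightarrow> \<B> \<subseteq> Pow X \<and> \<B> \<noteq> {} \<and>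
     (\<forall>B\<in>\<B>. \<forall>A. A \<subseteq> B \<longrightarrow> A \<in> \<B>) \<and>
     (\<forall>\<F>. \<F> \<subseteq> \<B> \<and> finite \<F> \<longrightarrow> \<Union>\<F> \<in> \<B>)"

definition bornology :: "'a set \<Rightarrow> 'a set set \<Rightarrow> bool" where
  "bornology X \<B> \<longleftrightarrow> generalized_bornology X \<B> \<and> (\<forall>A. A \<subseteq> X \<and> finite A \<longrightarrow> A \<in> \<B>)"

definition coarse_structure :: "'a set \<Rightarrow> ('a \<times> 'a) set set \<Rightarrow> bool" where
  "coarse_structure X \<C> \<longleftrightarrow> \<C> \<subseteq> Pow (X \<times> X) \<and> Id_on X \<in> \<C> \<and>
     (\<forall>U\<in>\<C>. \<forall>V. V \<subseteq> U \<longrightarrow> V \<in> \<C>) \<and>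
     (\<forall>\<F>. \<F> \<subseteq> \<C> \<and> finite \<F> \<longrightarrow> \<Union>\<F> \<in> \<C>) \<and>
     (\<forall>U\<in>\<C>. U\<inverse> \<in> \<C>) \<and>
     (\<forall>U\<in>\<C>. \<forall>V\<in>\<C>. U O V \<in> \<C>)"

definition thickening :: "('a \<times> 'a) set \<Rightarrow> 'a set \<Rightarrow> 'a set" where
  "thickening U B = {x. \<exists>b\<in>B. (x, b) \<in> U}"

definition compatible :: "('a \<times> 'a) set set \<Rightarrow> 'a set set \<Rightarrow> bool" where
  "compatible \<C> \<B> \<longleftrightarrow> (\<forall>U\<in>\<C>. \<forall>B\<in>\<B>. thickening U B \<in> \<B>)"

section \<open>Equivariant (generalized) bornological coarse spaces\<close>

record ('g, 'a) bcspace =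
  points :: "'a set"
  bounded_sets :: "'a set set"
  entourages :: "('a \<times> 'a) set set"
  act :: "'g \<Rightarrow> 'a \<Rightarrow> 'a"

text \<open>Maps between spaces are extensional functions (undefined outside the set of points), so
  that equality in HOL is equality of maps.\<close>

definition bc_morphism :: "('g, 'a) bcspace \<Rightarrow> ('g, 'a) bcspace \<Rightarrow> ('a \<Rightarrow> 'a) \<Rightarrow> bool" where
  "bc_morphism X Y f \<longleftrightarrow> f \<in> points X \<rightarrow>\<^sub>E points Y \<and>
     (\<forall>B\<in>bounded_sets Y. f -` B \<inter> points X \<in> bounded_sets X) \<and>
     (\<forall>U\<in>entourages X. map_prod f f ` U \<in> entourages Y)"

definition bc_automorphism :: "('g, 'a) bcspace \<Rightarrow> ('a \<Rightarrow> 'a) \<Rightarrow> bool" where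
  "bc_automorphism X f \<longleftrightarrow> bc_morphism X X f \<and>
     (\<exists>h. bc_morphism X X h \<and> (\<forall>x\<in>points X. h (f x) = x \<and> f (h x) = x))"

text \<open>The action is extensional in the group argument as well, so that each space has exactly one
  representation.\<close>

definition equivariant_generalized_bcspace ::
  "('g, 'k) monoid_scheme \<Rightarrow> ('g, 'a) bcspace \<Rightarrow> bool" where
  "equivariant_generalized_bcspace \<Gamma> X \<longleftrightarrow>
     generalized_bornology (points X) (bounded_sets X) \<and>
     coarse_structure (points X) (entourages X) \<and>
     compatible (entourages X) (bounded_sets X) \<and>
     group_action \<Gamma> (points X) (act X) \<and>
     act X \<in> extensional (carrier \<Gamma>) \<and>
     (\<forall>g\<in>carrier \<Gamma>. bc_automorphism X (act X g)) \<and>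
     (\<forall>U\<in>entourages X. \<exists>V\<in>entourages X. U \<subseteq> V \<and>
        (\<forall>g\<in>carrier \<Gamma>. map_prod (act X g) (act X g) ` V = V))"

definition equivariant_bcspace :: "('g, 'k) monoid_scheme \<Rightarrow> ('g, 'a) bcspace \<Rightarrow> bool" where
  "equivariant_bcspace \<Gamma> X \<longleftrightarrow>
     equivariant_generalized_bcspace \<Gamma> X \<and> bornology (points X) (bounded_sets X)"

definition equivariant_morphisms ::
  "('g, 'k) monoid_scheme \<Rightarrow> ('g, 'a) bcspace \<Rightarrow> ('g, 'a) bcspace \<Rightarrow> ('a \<Rightarrow> 'a) set" where
  "equivariant_morphisms \<Gamma> X Y = {f. bc_morphism X Y f \<and>
     (\<forall>g\<in>carrier \<Gamma>. \<forall>x\<in>points X. f (act X g x) = act Y g (f x))}"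

section \<open>The categories and the inclusion functor\<close>

text \<open>Since HOL has no type of all sets, the categories are taken relative to a collection \<open>\<U>\<close>
  of sets over a type, the \<^emph>\<open>small\<close> sets, from which the sets of points are drawn.
  \<open>\<U>\<close> is only required to be closed under subsets and to contain an infinite set. Thus
  \<open>\<U>\<close> may be all sets over an infinite type, or, when the type models a Grothendieck
  universe containing an infinite set, the sets which are its elements.\<close>

definition small_sets :: "'a set set \<Rightarrow> bool" where
  "small_sets \<U> \<longleftrightarrow> (\<forall>A\<in>\<U>. \<forall>B. B \<subseteq> A \<longrightarrow> B \<in> \<U>) \<and> (\<exists>A\<in>\<U>. infinite A)"

definition GenBornCoarse ::
  "('g, 'k) monoid_scheme \<Rightarrow> 'a set set \<Rightarrow> (('g, 'a) bcspace, 'a \<Rightarrow> 'a) cat" where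
  "GenBornCoarse \<Gamma> \<U> =
     \<lparr>Ob = {X. points X \<in> \<U> \<and> equivariant_generalized_bcspace \<Gamma> X},
      Hom = equivariant_morphisms \<Gamma>,
      Id = (\<lambda>X. \<lambda>x\<in>points X. x),
      Comp = (\<lambda>X Y Z g f. compose (points X) g f)\<rparr>"

definition BornCoarse ::
  "('g, 'k) monoid_scheme \<Rightarrow> 'a set set \<Rightarrow> (('g, 'a) bcspace, 'a \<Rightarrow> 'a) cat" where
  "BornCoarse \<Gamma> \<U> =
     \<lparr>Ob = {X. points X \<in> \<U> \<and> equivariant_bcspace \<Gamma> X},
      Hom = equivariant_morphisms \<Gamma>,
      Id = (\<lambda>X. \<lambda>x\<in>points X. x),
      Comp = (\<lambda>X Y Z g f. compose (points X) g f)\<rparr>"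

definition born_inclusion ::
  "(('g, 'a) bcspace, 'a \<Rightarrow> 'a, ('g, 'a) bcspace, 'a \<Rightarrow> 'a) fctr" where
  "born_inclusion = \<lparr>OMap = (\<lambda>X. X), MMap = (\<lambda>X Y f. f)\<rparr>"

end

theory Submission
  imports Defs
begin

text \<open>A point whose only bounded set is empty admits no morphism to a bornological coarse space,
  as the preimage of the bounded set consisting of its image would be unbounded. Hence
  \<open>Hom (L P) (L P)\<close>, which contains the identity, would be in bijection with the empty set
  \<open>Hom P (L P)\<close> for a left adjoint \<open>L\<close>. On the other hand every \<open>X\<close> with discrete coarse structure
  and trivial action has exactly one morphism to this point \<open>P\<close>, so for a right adjoint \<open>R\<close> there
  would be exactly one morphism \<open>X \<rightarrow> R P\<close>. Applied to one-point spaces, this shows that \<open>R P\<close> has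
  exactly one fixed point; applied to an infinite \<open>X\<close> whose bounded sets are the finite ones,
  it yields a proper map that is constant with value this fixed point, which is absurd.\<close>

section \<open>Equivariant morphisms and the two categories\<close>

lemma equivariant_morphismsI:
  assumes "f \<in> points X \<rightarrow>\<^sub>E points Y"
    and "\<And>B. B \<in> bounded_sets Y \<Longrightarrow> f -` B \<inter> points X \<in> bounded_sets X"
    and "\<And>U. U \<in> entourages X \<Longrightarrow> map_prod f f ` U \<in> entourages Y"
    and "\<And>g x. g \<in> carrier \<Gamma> \<Longrightarrow> x \<in> points X \<Longrightarrow> f (act X g x) = act Y g (f x)"
  shows "f \<in> equivariant_morphisms \<Gamma> X Y"
  using assms by (simp add: equivariant_morphisms_def bc_morphism_def)

lemma equivariant_morphismsD:
  assumes "f \<in> equivariant_morphisms \<Gamma> X Y"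
  shows "f \<in> points X \<rightarrow>\<^sub>E points Y"
    and "B \<in> bounded_sets Y \<Longrightarrow> f -` B \<inter> points X \<in> bounded_sets X"
    and "U \<in> entourages X \<Longrightarrow> map_prod f f ` U \<in> entourages Y"
    and "g \<in> carrier \<Gamma> \<Longrightarrow> x \<in> points X \<Longrightarrow> f (act X g x) = act Y g (f x)"
  using assms by (simp_all add: equivariant_morphisms_def bc_morphism_def)

lemma entourages_subset:
  assumes "equivariant_generalized_bcspace \<Gamma> X" and "U \<in> entourages X"
  shows "U \<subseteq> points X \<times> points X"
  using assms by (auto simp: equivariant_generalized_bcspace_def coarse_structure_def)

lemma bounded_sets_subset:
  assumes "equivariant_generalized_bcspace \<Gamma> X" and "B \<in> bounded_sets X"
  shows "B \<subseteq> points X"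
  using assms by (auto simp: equivariant_generalized_bcspace_def generalized_bornology_def)

lemma act_closed:
  assumes "equivariant_generalized_bcspace \<Gamma> X" and "g \<in> carrier \<Gamma>" and "x \<in> points X"
  shows "act X g x \<in> points X"
  using assms group_action.element_image[of \<Gamma> "points X" "act X"]
  by (auto simp: equivariant_generalized_bcspace_def)

lemma id_equivariant_morphism:
  assumes X: "equivariant_generalized_bcspace \<Gamma> X"
  shows "(\<lambda>x\<in>points X. x) \<in> equivariant_morphisms \<Gamma> X X"
proof (rule equivariant_morphismsI)
  fix B assume B: "B \<in> bounded_sets X"
  have "(\<lambda>x\<in>points X. x) -` B \<inter> points X = B"
    using bounded_sets_subset[OF X B] by auto
  with B show "(\<lambda>x\<in>points X. x) -` B \<inter> points X \<in> bounded_sets X" by simp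
next
  fix U assume U: "U \<in> entourages X"
  \<comment> \<open>The restricted identity agrees with \<open>id\<close> only on
    \<open>points X\<close>, so the inclusion of \<open>U\<close> in the square of the points is
    what makes the two images equal.\<close>
  have "map_prod (\<lambda>x\<in>points X. x) (\<lambda>x\<in>points X. x) ` U = id ` U"
    using entourages_subset[OF X U] by (intro image_cong) auto
  with U show "map_prod (\<lambda>x\<in>points X. x) (\<lambda>x\<in>points X. x) ` U \<in> entourages X" by simp
qed (auto simp: act_closed[OF X])

lemma compose_equivariant_morphism:
  assumes X: "equivariant_generalized_bcspace \<Gamma> X"
    and f: "f \<in> equivariant_morphisms \<Gamma> X Y" and g: "g \<in> equivariant_morphisms \<Gamma> Y Z"
  shows "compose (points X) g f \<in> equivariant_morphisms \<Gamma> X Z"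
proof (rule equivariant_morphismsI)
  note f_pts = equivariant_morphismsD(1)[OF f]
  show "compose (points X) g f \<in> points X \<rightarrow>\<^sub>E points Z"
    using f_pts equivariant_morphismsD(1)[OF g] by (auto simp: compose_def)
  show "compose (points X) g f -` B \<inter> points X \<in> bounded_sets X" if "B \<in> bounded_sets Z" for B
  proof -
    have "compose (points X) g f -` B \<inter> points X = f -` (g -` B \<inter> points Y) \<inter> points X"
      using f_pts by (auto simp: compose_def)
    then show ?thesis
      using equivariant_morphismsD(2)[OF f equivariant_morphismsD(2)[OF g that]] by simp
  qed
  show "map_prod (compose (points X) g f) (compose (points X) g f) ` U \<in> entourages Z"
    if U: "U \<in> entourages X" for U
  proof -
    have "map_prod (compose (points X) g f) (compose (points X) g f) ` U
        = map_prod g g ` map_prod f f ` U"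
      unfolding image_image using entourages_subset[OF X U]
      by (intro image_cong) (auto simp: compose_def)
    then show ?thesis
      using equivariant_morphismsD(3)[OF g equivariant_morphismsD(3)[OF f U]] by simp
  qed
  show "compose (points X) g f (act X h x) = act Z h (compose (points X) g f x)"
    if "h \<in> carrier \<Gamma>" "x \<in> points X" for h x
    using that f_pts act_closed[OF X that]
      equivariant_morphismsD(4)[OF f that] equivariant_morphismsD(4)[OF g, of h "f x"]
    by (auto simp: compose_def)
qed

text \<open>The set of objects \<open>S\<close> is left arbitrary so that one proof serves both
  categories. The unit laws are equalities of HOL functions because morphisms are
  extensional.\<close>

lemma category_equivariant_morphisms:
  fixes S :: "('a, 'b) bcspace set"
  assumes "\<And>X. X \<in> S \<Longrightarrow> equivariant_generalized_bcspace \<Gamma> X"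
  shows "category \<lparr>Ob = S, Hom = equivariant_morphisms \<Gamma>, Id = (\<lambda>X. \<lambda>x\<in>points X. x),
      Comp = (\<lambda>X Y Z g f. compose (points X) g f)\<rparr>"
proof -
  have unit: "compose (points X) f (\<lambda>x\<in>points X. x) = f"
    "compose (points X) (\<lambda>y\<in>points Y. y) f = f"
    if "f \<in> equivariant_morphisms \<Gamma> X Y" for f and X Y :: "('a, 'b) bcspace"
    using equivariant_morphismsD(1)[OF that]
    by (auto simp: PiE_iff intro!: compose_Id Id_compose)
  have assoc: "compose (points W) h (compose (points W) g f)
      = compose (points W) (compose (points X) h g) f"
    if "f \<in> equivariant_morphisms \<Gamma> W X" for f g h and W X :: "('a, 'b) bcspace"
    using equivariant_morphismsD(1)[OF that] by (intro compose_assoc) auto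
  show ?thesis
    unfolding category_def
    by (auto intro: assms id_equivariant_morphism compose_equivariant_morphism unit assoc)
qed

text \<open>Both categories use the same hom-sets, identities and composition, and the functor is
  the identity on objects and morphisms. Apart from the category axioms, only the inclusion of the
  objects remains.\<close>

lemma fully_faithful_embedding_born_inclusion:
  "fully_faithful_embedding (BornCoarse \<Gamma> \<U>) (GenBornCoarse \<Gamma> \<U>) born_inclusion"
proof -
  have "category (BornCoarse \<Gamma> \<U>)" "category (GenBornCoarse \<Gamma> \<U>)"
    unfolding BornCoarse_def GenBornCoarse_def
    by (rule category_equivariant_morphisms; simp add: equivariant_bcspace_def)+
  then show ?thesis
    by (auto simp: fully_faithful_embedding_def fully_faithful_def is_functor_def bij_betw_def
        born_inclusion_def BornCoarse_def GenBornCoarse_def equivariant_bcspace_def inj_on_def)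
qed

section \<open>Discrete spaces with trivial action\<close>

text \<open>\<open>Pow (Id_on A)\<close> is the smallest coarse structure on \<open>A\<close>. Both
  restrictions in \<open>act\<close> are needed for extensionality: in the group element, and in the
  point so that the values lie in \<open>BijGroup A\<close>.\<close>

definition discrete_space ::
  "('g, 'k) monoid_scheme \<Rightarrow> 'a set \<Rightarrow> 'a set set \<Rightarrow> ('g, 'a) bcspace" where
  "discrete_space \<Gamma> A \<B> =
     \<lparr>points = A, bounded_sets = \<B>, entourages = Pow (Id_on A),
      act = (\<lambda>g\<in>carrier \<Gamma>. \<lambda>x\<in>A. x)\<rparr>"

text \<open>The restricted identity is the unit of \<open>BijGroup A\<close>, so this is the
  constant homomorphism.\<close>

lemma group_action_trivial:
  assumes "group \<Gamma>"
  shows "group_action \<Gamma> A (\<lambda>g\<in>carrier \<Gamma>. \<lambda>x\<in>A. x)"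
proof -
  have "monoid \<Gamma>" using assms by (rule group.axioms)
  moreover have "(\<lambda>x\<in>A. x) \<in> Bij A" by (rule id_Bij)
  ultimately have "(\<lambda>g\<in>carrier \<Gamma>. \<lambda>x\<in>A. x) \<in> hom \<Gamma> (BijGroup A)"
    by (auto simp: hom_def BijGroup_def monoid.m_closed compose_def)
  then show ?thesis
    using assms group_BijGroup[of A]
    by (simp add: group_action_def group_hom_def group_hom_axioms_def)
qed

lemma coarse_structure_discrete: "coarse_structure A (Pow (Id_on A))"
  unfolding coarse_structure_def by (intro conjI) auto

text \<open>Thickening by a subset of the diagonal can only shrink a bounded set, which gives
  compatibility. Every group element acts as the restricted identity, which is its own inverse, and
  every entourage is itself invariant.\<close>

lemma equivariant_generalized_bcspace_discrete:
  assumes "group \<Gamma>" and \<B>: "generalized_bornology A \<B>"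
  shows "equivariant_generalized_bcspace \<Gamma> (discrete_space \<Gamma> A \<B>)"
proof -
  have sub: "B \<subseteq> A" if "B \<in> \<B>" for B
    using \<B> that by (auto simp: generalized_bornology_def)
  have down: "C \<in> \<B>" if "B \<in> \<B>" "C \<subseteq> B" for B C
    using \<B> that by (auto simp: generalized_bornology_def)
  have compat: "compatible (Pow (Id_on A)) \<B>"
    unfolding compatible_def by (auto simp: thickening_def intro: down)
  have pre: "(\<lambda>x\<in>A. x) -` B \<inter> A = B" if "B \<in> \<B>" for B
    using sub[OF that] by auto
  have img: "map_prod (\<lambda>x\<in>A. x) (\<lambda>x\<in>A. x) ` U = U" if "U \<subseteq> Id_on A" for U
  proof -
    have "map_prod (\<lambda>x\<in>A. x) (\<lambda>x\<in>A. x) ` U = id ` U"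
      using that by (intro image_cong) auto
    then show ?thesis by simp
  qed
  have mor: "bc_morphism (discrete_space \<Gamma> A \<B>) (discrete_space \<Gamma> A \<B>) (\<lambda>x\<in>A. x)"
    by (auto simp: bc_morphism_def discrete_space_def pre img)
  have "bc_automorphism (discrete_space \<Gamma> A \<B>) (\<lambda>x\<in>A. x)"
    unfolding bc_automorphism_def using mor
    by (intro conjI exI[of _ "\<lambda>x\<in>A. x"]) (auto simp: discrete_space_def)
  then show ?thesis
    unfolding equivariant_generalized_bcspace_def
    using \<B> compat coarse_structure_discrete group_action_trivial[OF \<open>group \<Gamma>\<close>] img
    by (auto simp: discrete_space_def)
qed

text \<open>Any map sends a subset of the diagonal into the diagonal of \<open>Y\<close>, which is
  an entourage, so being controlled is automatic. As the action on \<open>A\<close> is trivial,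
  equivariance says that all values are fixed points.\<close>

lemma discrete_space_morphism_iff:
  assumes Y: "equivariant_generalized_bcspace \<Gamma> Y"
  shows "f \<in> equivariant_morphisms \<Gamma> (discrete_space \<Gamma> A \<B>) Y \<longleftrightarrow>
    f \<in> A \<rightarrow>\<^sub>E points Y \<and> (\<forall>B\<in>bounded_sets Y. f -` B \<inter> A \<in> \<B>) \<and>
    (\<forall>g\<in>carrier \<Gamma>. \<forall>x\<in>A. act Y g (f x) = f x)"
proof -
  have "map_prod f f ` U \<in> entourages Y" if "f \<in> A \<rightarrow>\<^sub>E points Y" "U \<subseteq> Id_on A" for U
  proof -
    have "map_prod f f ` U \<subseteq> Id_on (points Y)" using that by auto
    moreover have "\<forall>U\<in>entourages Y. \<forall>V. V \<subseteq> U \<longrightarrow> V \<in> entourages Y"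
      and "Id_on (points Y) \<in> entourages Y"
      using Y by (simp_all add: equivariant_generalized_bcspace_def coarse_structure_def)
    ultimately show ?thesis by blast
  qed
  then show ?thesis
    by (auto simp: equivariant_morphisms_def bc_morphism_def discrete_space_def)
qed

lemma bounded_singleton:
  assumes "equivariant_bcspace \<Gamma> Y" and "y \<in> points Y"
  shows "{y} \<in> bounded_sets Y"
  using assms by (simp add: equivariant_bcspace_def bornology_def)

section \<open>Test spaces: the unbounded point and discrete spaces with finite bounded sets\<close>

abbreviation unbounded_point :: "('g, 'k) monoid_scheme \<Rightarrow> 'a \<Rightarrow> ('g, 'a) bcspace" where
  "unbounded_point \<Gamma> a \<equiv> discrete_space \<Gamma> {a} {{}}"

lemma unbounded_point_object:
  assumes "group \<Gamma>" and "{a} \<in> \<U>"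
  shows "unbounded_point \<Gamma> a \<in> Ob (GenBornCoarse \<Gamma> \<U>)"
proof -
  have "generalized_bornology {a} {{}}"
    by (auto simp: generalized_bornology_def)
  then show ?thesis
    using assms equivariant_generalized_bcspace_discrete[OF \<open>group \<Gamma>\<close>]
    by (auto simp: GenBornCoarse_def discrete_space_def)
qed

lemma no_morphism_from_unbounded_point:
  assumes Y: "equivariant_bcspace \<Gamma> Y"
  shows "equivariant_morphisms \<Gamma> (unbounded_point \<Gamma> a) Y = {}"
proof (rule equals0I)
  fix f assume "f \<in> equivariant_morphisms \<Gamma> (unbounded_point \<Gamma> a) Y"
  then have "f a \<in> points Y" and "\<forall>B\<in>bounded_sets Y. f -` B \<inter> {a} = {}"
    using Y by (auto simp: discrete_space_morphism_iff equivariant_bcspace_def)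
  with bounded_singleton[OF Y] show False by blast
qed

text \<open>There is only one extensional map into a point. It is proper as soon as the empty set is
  bounded in the source, since the only bounded set of the target is empty.\<close>

lemma ex1_morphism_to_unbounded_point:
  assumes "group \<Gamma>" and "{} \<in> \<B>"
  shows "\<exists>!f. f \<in> equivariant_morphisms \<Gamma> (discrete_space \<Gamma> A \<B>) (unbounded_point \<Gamma> a)"
proof -
  have "generalized_bornology {a} {{}}"
    by (auto simp: generalized_bornology_def)
  note iff = discrete_space_morphism_iff[OF
      equivariant_generalized_bcspace_discrete[OF \<open>group \<Gamma>\<close> this]]
  show ?thesis
  proof (rule ex1I[of _ "\<lambda>x\<in>A. a"])
    show "(\<lambda>x\<in>A. a) \<in> equivariant_morphisms \<Gamma> (discrete_space \<Gamma> A \<B>) (unbounded_point \<Gamma> a)"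
      unfolding iff using \<open>{} \<in> \<B>\<close> by (auto simp: discrete_space_def)
    show "f = (\<lambda>x\<in>A. a)"
      if "f \<in> equivariant_morphisms \<Gamma> (discrete_space \<Gamma> A \<B>) (unbounded_point \<Gamma> a)" for f
      using that unfolding iff
      by (auto simp: discrete_space_def PiE_def extensional_def)
  qed
qed

abbreviation finitely_bounded :: "('g, 'k) monoid_scheme \<Rightarrow> 'a set \<Rightarrow> ('g, 'a) bcspace" where
  "finitely_bounded \<Gamma> A \<equiv> discrete_space \<Gamma> A {B. B \<subseteq> A \<and> finite B}"

lemma finitely_bounded_object:
  assumes "group \<Gamma>" and "A \<in> \<U>"
  shows "finitely_bounded \<Gamma> A \<in> Ob (BornCoarse \<Gamma> \<U>)"
proof -
  have "bornology A {B. B \<subseteq> A \<and> finite B}"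
    unfolding bornology_def generalized_bornology_def
    by (auto intro: finite_subset)
  then show ?thesis
    using assms equivariant_generalized_bcspace_discrete[OF \<open>group \<Gamma>\<close>]
    by (auto simp: BornCoarse_def equivariant_bcspace_def bornology_def discrete_space_def)
qed

section \<open>Non-existence of the adjoints\<close>

lemma not_has_left_adjoint_born_inclusion:
  assumes "group \<Gamma>" and "{a} \<in> \<U>"
  shows "\<not> has_left_adjoint (BornCoarse \<Gamma> \<U>) (GenBornCoarse \<Gamma> \<U>) born_inclusion"
proof
  assume "has_left_adjoint (BornCoarse \<Gamma> \<U>) (GenBornCoarse \<Gamma> \<U>) born_inclusion"
  then obtain L \<Phi> where adj:
      "adjunction (GenBornCoarse \<Gamma> \<U>) (BornCoarse \<Gamma> \<U>) L born_inclusion \<Phi>"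
    unfolding has_left_adjoint_def by blast
  let ?P = "unbounded_point \<Gamma> a"
  let ?LP = "OMap L ?P"
  have P: "?P \<in> Ob (GenBornCoarse \<Gamma> \<U>)"
    using assms by (rule unbounded_point_object)
  with adj have LP: "?LP \<in> Ob (BornCoarse \<Gamma> \<U>)"
    by (simp add: adjunction_def is_functor_def)
  then have LP': "equivariant_bcspace \<Gamma> ?LP"
    by (simp add: BornCoarse_def)
  have "bij_betw (\<Phi> ?P ?LP) (equivariant_morphisms \<Gamma> ?LP ?LP) (equivariant_morphisms \<Gamma> ?P ?LP)"
    using adj P LP
    by (simp add: adjunction_def born_inclusion_def BornCoarse_def GenBornCoarse_def)
  then have "equivariant_morphisms \<Gamma> ?LP ?LP = {}"
    using no_morphism_from_unbounded_point[OF LP'] by (simp add: bij_betw_def)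
  then show False
    using id_equivariant_morphism[of \<Gamma> ?LP] LP' by (auto simp: equivariant_bcspace_def)
qed

text \<open>Singletons of \<open>A\<close> supply both the unbounded point and the one-point test
  space; the infinite set \<open>A\<close> supplies the final contradiction.\<close>

lemma not_has_right_adjoint_born_inclusion:
  assumes "group \<Gamma>" and "A \<in> \<U>" and "infinite A" and "\<And>a. a \<in> A \<Longrightarrow> {a} \<in> \<U>"
  shows "\<not> has_right_adjoint (BornCoarse \<Gamma> \<U>) (GenBornCoarse \<Gamma> \<U>) born_inclusion"
proof
  assume "has_right_adjoint (BornCoarse \<Gamma> \<U>) (GenBornCoarse \<Gamma> \<U>) born_inclusion"
  then obtain R \<Phi> where adj:
      "adjunction (BornCoarse \<Gamma> \<U>) (GenBornCoarse \<Gamma> \<U>) born_inclusion R \<Phi>"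
    unfolding has_right_adjoint_def by blast
  obtain a where a: "a \<in> A"
    using \<open>infinite A\<close> by (metis finite.emptyI ex_in_conv)
  let ?P = "unbounded_point \<Gamma> a"
  define T where "T = OMap R ?P"
  have P: "?P \<in> Ob (GenBornCoarse \<Gamma> \<U>)"
    using assms a by (intro unbounded_point_object)
  with adj have "T \<in> Ob (BornCoarse \<Gamma> \<U>)"
    by (simp add: adjunction_def is_functor_def T_def)
  then have T: "equivariant_bcspace \<Gamma> T"
    by (simp add: BornCoarse_def)
  then have gT: "equivariant_generalized_bcspace \<Gamma> T"
    by (simp add: equivariant_bcspace_def)
  note iff = discrete_space_morphism_iff[OF gT]
  have ex1: "\<exists>!f. f \<in> equivariant_morphisms \<Gamma> (finitely_bounded \<Gamma> S) T" if "S \<in> \<U>" for S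
  proof -
    let ?X = "finitely_bounded \<Gamma> S"
    have "?X \<in> Ob (BornCoarse \<Gamma> \<U>)"
      using assms that by (intro finitely_bounded_object)
    then have bij: "bij_betw (\<Phi> ?X ?P) (equivariant_morphisms \<Gamma> ?X ?P)
        (equivariant_morphisms \<Gamma> ?X T)"
      using adj P by (simp add: adjunction_def born_inclusion_def BornCoarse_def
          GenBornCoarse_def T_def)
    \<comment> \<open>Being a singleton means having cardinality 1, so unique existence passes along
      the bijection of hom-sets.\<close>
    have "is_singleton (equivariant_morphisms \<Gamma> ?X ?P)"
      unfolding is_singleton_def
      using ex1_morphism_to_unbounded_point[OF \<open>group \<Gamma>\<close>, of "{B. B \<subseteq> S \<and> finite B}" S a]
      by auto
    then have "is_singleton (equivariant_morphisms \<Gamma> ?X T)"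
      using bij_betw_same_card[OF bij] by (simp add: is_singleton_altdef)
    then show ?thesis by (auto simp: is_singleton_def)
  qed
  have fixed_unique: "s = t"
    if st: "s \<in> points T" "t \<in> points T"
      "\<forall>g\<in>carrier \<Gamma>. act T g s = s" "\<forall>g\<in>carrier \<Gamma>. act T g t = t" for s t
  proof -
    \<comment> \<open>Every subset of \<open>{a}\<close> is bounded in this source, so each fixed
      point of \<open>T\<close> gives a morphism, and different fixed points give different
      morphisms.\<close>
    have const: "(\<lambda>x\<in>{a}. u) \<in> equivariant_morphisms \<Gamma> (finitely_bounded \<Gamma> {a}) T"
      if "u \<in> points T" "\<forall>g\<in>carrier \<Gamma>. act T g u = u" for u
      unfolding iff using that by auto
    have "(\<lambda>x\<in>{a}. s) = (\<lambda>x\<in>{a}. t)"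
      using ex1[OF assms(4)[OF a]] const st by blast
    from fun_cong[OF this, of a] show ?thesis by simp
  qed
  obtain f where "f \<in> equivariant_morphisms \<Gamma> (finitely_bounded \<Gamma> A) T"
    using ex1[OF \<open>A \<in> \<U>\<close>] by blast
  then have f: "f \<in> A \<rightarrow>\<^sub>E points T"
      "\<And>B. B \<in> bounded_sets T \<Longrightarrow> finite (f -` B \<inter> A)"
      "\<And>g x. g \<in> carrier \<Gamma> \<Longrightarrow> x \<in> A \<Longrightarrow> act T g (f x) = f x"
    unfolding iff by auto
  have "f x = f a" if "x \<in> A" for x
    using f(1) f(3) that a by (intro fixed_unique) auto
  then have "f -` {f a} \<inter> A = A" by auto
  moreover have "{f a} \<in> bounded_sets T"
    using f(1) a by (intro bounded_singleton[OF T]) auto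
  ultimately show False
    using f(2)[of "{f a}"] \<open>infinite A\<close> by simp
qed

theorem proposition6p1:
  fixes \<Gamma> :: "('g, 'k) monoid_scheme" and \<U> :: "'a set set"
  assumes "group \<Gamma>" and "small_sets \<U>"
  shows "fully_faithful_embedding (BornCoarse \<Gamma> \<U>) (GenBornCoarse \<Gamma> \<U>) born_inclusion \<and>
    \<not> has_left_adjoint (BornCoarse \<Gamma> \<U>) (GenBornCoarse \<Gamma> \<U>) born_inclusion \<and>
    \<not> has_right_adjoint (BornCoarse \<Gamma> \<U>) (GenBornCoarse \<Gamma> \<U>) born_inclusion"
proof -
  \<comment> \<open>Closure under subsets makes the singletons inside the infinite small set
    small.\<close>
  obtain A where A: "A \<in> \<U>" "infinite A" and singleton: "\<And>a. a \<in> A \<Longrightarrow> {a} \<in> \<U>"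
    using \<open>small_sets \<U>\<close> unfolding small_sets_def by (metis empty_subsetI insert_subset)
  then obtain a where "a \<in> A"
    by (metis finite.emptyI ex_in_conv)
  then show ?thesis
    using fully_faithful_embedding_born_inclusion
      not_has_left_adjoint_born_inclusion[OF \<open>group \<Gamma>\<close> singleton]
      not_has_right_adjoint_born_inclusion[OF \<open>group \<Gamma>\<close> A singleton]
    by blast
qed

end
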